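(* For every $\varepsilon>0$ there is a constant $K=K(\varepsilon)>0$ such that for every integer $d\ge 2$ and every real number $c\ge K d$ the following holds: there is a positive integer $n_0$ such that for every integer $n\ge n_0$ there exists an axis-parallel $c$-chain in $\mathbb{R}^d$ with $n$ vertices and stretch factor at least $$(n-1)^{(1-\varepsilon)(d-1)/d}.$$
   Context: A polygonal chain $P=(p_1,\dots,p_n)$ in $\mathbb{R}^d$ is specified by a sequence of $n$ points $p_1,\dots,p_n$, called its vertices; it consists of the $n-1$ line segments (edges) between consecutive vertices. It is axis-parallel if every edge is parallel to a coordinate axis. $|pq|$ denotes the Euclidean distance between $p$ and $q$. For a real number $c\ge 1$, $P$ is called a $c$-chain if $|p_ip_j|+|p_jp_k|\le c\,|p_ip_k|$ for all $1\le i<j<k\le n$. The stretch factor of $P$ is $$\delta_P=\frac{\sum_{i=1}^{n-1}|p_ip_{i+1}|}{|p_1p_n|}.$$ *)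

theory Defs
  imports "HOL-Analysis.Analysis"
begin

(* The dimension d must be bound inside the statement, after a constant that does not depend
   on it.  Points of R^d are therefore elements of topspace (Euclidean_space d), that is,
   functions nat => real vanishing at all indices >= d. *)

definition edist :: "nat \<Rightarrow> (nat \<Rightarrow> real) \<Rightarrow> (nat \<Rightarrow> real) \<Rightarrow> real" where
  "edist d p q = L2_set (\<lambda>i. p i - q i) {..<d}"

(* The list P = [p_1, ..., p_n] is indexed from 0, so p_i is P ! (i - 1). *)

definition polygonal_chain :: "nat \<Rightarrow> (nat \<Rightarrow> real) list \<Rightarrow> bool" where
  "polygonal_chain d P \<longleftrightarrow> P \<noteq> [] \<and> set P \<subseteq> topspace (Euclidean_space d)"

(* The condition p a \<noteq> q a excludes zero-length edges, which have no direction.  In particular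
   a chain cannot be lengthened by repeating a vertex. *)

definition axis_parallel_segment :: "nat \<Rightarrow> (nat \<Rightarrow> real) \<Rightarrow> (nat \<Rightarrow> real) \<Rightarrow> bool" where
  "axis_parallel_segment d p q \<longleftrightarrow>
     (\<exists>a<d. p a \<noteq> q a \<and> (\<forall>b<d. b \<noteq> a \<longrightarrow> p b = q b))"

definition axis_parallel :: "nat \<Rightarrow> (nat \<Rightarrow> real) list \<Rightarrow> bool" where
  "axis_parallel d P \<longleftrightarrow>
     (\<forall>i. Suc i < length P \<longrightarrow> axis_parallel_segment d (P ! i) (P ! Suc i))"

definition c_chain :: "nat \<Rightarrow> real \<Rightarrow> (nat \<Rightarrow> real) list \<Rightarrow> bool" where
  "c_chain d c P \<longleftrightarrow> polygonal_chain d P \<and> c \<ge> 1 \<and>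
     (\<forall>i j k. i < j \<longrightarrow> j < k \<longrightarrow> k < length P \<longrightarrow>
        edist d (P ! i) (P ! j) + edist d (P ! j) (P ! k) \<le> c * edist d (P ! i) (P ! k))"

definition stretch_factor :: "nat \<Rightarrow> (nat \<Rightarrow> real) list \<Rightarrow> real" where
  "stretch_factor d P =
     (\<Sum>i<length P - 1. edist d (P ! i) (P ! Suc i)) / edist d (hd P) (last P)"

end

theory Submission
  imports Defs
begin

text \<open>The chain is a finite stage of a self-similar fractal arc. Take a simple lattice path from
  \<open>0\<close> to \<open>m e\<^sub>0\<close> with \<open>N\<close> edges and replace every edge, again and again, by a rotated copy of the
  path scaled by \<open>1/m\<close>. All copies stay inside thin double cones around the edges: cones of
  disjoint edges are at distance at least \<open>1/2\<close>, and cones of consecutive edges touch at an angle.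
  Hence two points at distance \<open>r\<close> (in the maximum norm) bound a subarc of diameter at most
  \<open>(2m + 2) r\<close>, at every stage and in every dimension, and comparing the norms costs a factor at
  most \<open>d\<close>. The stretch factor of the \<open>k\<close>-th stage, which has \<open>N\<^sup>k\<close> edges, is \<open>(N/m)\<^sup>k\<close>. A
  boustrophedon path through a cube of side \<open>q\<close>, with straight pieces attached to both ends so
  that it fits into a double cone, has \<open>m = 6q + 3\<close> and \<open>N \<ge> 2(q + 1)\<^sup>d\<close>. So \<open>N/m\<close> exceeds
  \<open>N\<close> to the power \<open>(1 - \<epsilon>)(d - 1)/d\<close> as soon as \<open>q\<close> is large depending on \<open>\<epsilon>\<close> only.\<close>

section \<open>Maximum norm and double cones\<close>

text \<open>The maximum-norm distance is at most \<open>r\<close>. All indices are compared, not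
  only those below the dimension, so that rotated copies can be treated without reference to
  \<open>d\<close>.\<close>

definition near :: "real \<Rightarrow> (nat \<Rightarrow> real) \<Rightarrow> (nat \<Rightarrow> real) \<Rightarrow> bool" where
  "near r x y \<longleftrightarrow> (\<forall>j. \<bar>x j - y j\<bar> \<le> r)"

text \<open>The double cone around the edge from the origin to \<open>unit_vec\<close>, with a cube
  as cross-section. Its slope 1/2 makes it narrow enough (at most 1/4 to each side) that the cones
  of disjoint lattice edges stay apart and that cones meeting at a right angle touch only in their
  common tip.\<close>

definition spindle :: "(nat \<Rightarrow> real) set" where
  "spindle = {x. 0 \<le> x 0 \<and> x 0 \<le> 1 \<and> (\<forall>j. j \<noteq> 0 \<longrightarrow> 2 * \<bar>x j\<bar> \<le> x 0 \<and> 2 * \<bar>x j\<bar> \<le> 1 - x 0)}"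

definition unit_vec :: "nat \<Rightarrow> real" where
  "unit_vec = (\<lambda>j. if j = 0 then 1 else 0)"

text \<open>A linear isometry taking \<open>e\<^sub>0\<close> to \<open>\<sigma> e\<^sub>a\<close>.\<close>

definition turn :: "nat \<Rightarrow> int \<Rightarrow> (nat \<Rightarrow> real) \<Rightarrow> nat \<Rightarrow> real" where
  "turn a \<sigma> x = (\<lambda>j. if j = a then of_int \<sigma> * x 0 else if j = 0 then x a else x j)"

definition adjacent :: "nat \<Rightarrow> (nat \<Rightarrow> int) \<Rightarrow> (nat \<Rightarrow> int) \<Rightarrow> bool" where
  "adjacent d x y \<longleftrightarrow> (\<exists>a<d. \<exists>\<sigma>. \<bar>\<sigma>\<bar> = 1 \<and> y = x(a := x a + \<sigma>))"

definition lattice_path :: "nat \<Rightarrow> nat \<Rightarrow> (nat \<Rightarrow> nat \<Rightarrow> int) \<Rightarrow> bool" where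
  "lattice_path d M w \<longleftrightarrow> inj_on w {..<M} \<and> (\<forall>i. Suc i < M \<longrightarrow> adjacent d (w i) (w (Suc i)))"

lemma nearD: "near r x y \<Longrightarrow> \<bar>x j - y j\<bar> \<le> r"
  by (simp add: near_def)

lemma near_nonneg: "near r x y \<Longrightarrow> 0 \<le> r"
  using abs_ge_zero nearD order_trans by blast

lemma near_sym: "near r x y \<Longrightarrow> near r y x"
  by (simp add: near_def abs_minus_commute)

lemma near_mono: "near r x y \<Longrightarrow> r \<le> s \<Longrightarrow> near s x y"
  unfolding near_def using order_trans by blast

lemma near_trans: "near r x y \<Longrightarrow> near s y z \<Longrightarrow> near (r + s) x z"
  unfolding near_def
proof
  fix j assume "\<forall>j. \<bar>x j - y j\<bar> \<le> r" "\<forall>j. \<bar>y j - z j\<bar> \<le> s"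
  then have "\<bar>x j - y j\<bar> \<le> r" "\<bar>y j - z j\<bar> \<le> s" by auto
  then show "\<bar>x j - z j\<bar> \<le> r + s" by linarith
qed

lemma near_divide: "m > 0 \<Longrightarrow> near r (\<lambda>j. x j / m) (\<lambda>j. y j / m) \<longleftrightarrow> near (m * r) x y"
  by (simp add: near_def field_simps flip: diff_divide_distrib)

lemma spindleD:
  assumes "x \<in> spindle"
  shows "0 \<le> x 0" "x 0 \<le> 1" "j \<noteq> 0 \<Longrightarrow> 2 * \<bar>x j\<bar> \<le> x 0" "j \<noteq> 0 \<Longrightarrow> 2 * \<bar>x j\<bar> \<le> 1 - x 0"
  using assms by (auto simp: spindle_def)

lemma spindle_near_zero: "x \<in> spindle \<Longrightarrow> near (x 0) x (\<lambda>j. 0)"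
  unfolding near_def
proof
  fix j assume x: "x \<in> spindle"
  show "\<bar>x j - 0\<bar> \<le> x 0"
  proof (cases "j = 0")
    case False
    then show ?thesis using spindleD(3)[OF x False] by simp
  qed (use spindleD[OF x] in auto)
qed

lemma spindle_near_unit: "x \<in> spindle \<Longrightarrow> near (1 - x 0) x unit_vec"
  unfolding near_def
proof
  fix j assume x: "x \<in> spindle"
  show "\<bar>x j - unit_vec j\<bar> \<le> 1 - x 0"
  proof (cases "j = 0")
    case False
    then show ?thesis using spindleD(4)[OF x False] by (simp add: unit_vec_def)
  qed (use spindleD[OF x] in \<open>auto simp: unit_vec_def\<close>)
qed

lemma spindle_near: "x \<in> spindle \<Longrightarrow> y \<in> spindle \<Longrightarrow> near 1 x y"
  unfolding near_def
proof
  fix j assume x: "x \<in> spindle" and y: "y \<in> spindle"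
  show "\<bar>x j - y j\<bar> \<le> 1"
  proof (cases "j = 0")
    case False
    then show ?thesis using spindleD(2)[OF x] spindleD(2)[OF y] spindleD(3)[OF x False] spindleD(3)[OF y False]
      by linarith
  qed (use spindleD(1,2)[OF x] spindleD(1,2)[OF y] in auto)
qed

text \<open>Up to sign, \<open>turn\<close> only permutes coordinates, so every coordinate
  difference on one side reappears in absolute value on the other.\<close>

lemma near_turn: "\<bar>\<sigma>\<bar> = 1 \<Longrightarrow> near r (turn a \<sigma> x) (turn a \<sigma> y) \<longleftrightarrow> near r x y"
proof -
  assume s: "\<bar>\<sigma>\<bar> = 1"
  have a: "\<bar>of_int \<sigma> * b - of_int \<sigma> * c\<bar> = \<bar>b - c\<bar>" for b c :: real
    using s by (metis abs_mult mult_cancel_right1 of_int_1 of_int_abs right_diff_distrib')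
  have "\<exists>i. \<bar>turn a \<sigma> x j - turn a \<sigma> y j\<bar> = \<bar>x i - y i\<bar>" for j
    by (cases "j = a"; cases "j = 0") (auto simp: turn_def a)
  moreover have "\<exists>i. \<bar>turn a \<sigma> x i - turn a \<sigma> y i\<bar> = \<bar>x j - y j\<bar>" for j
  proof -
    consider "j = 0" | "j = a" "a \<noteq> 0" | "j \<noteq> 0" "j \<noteq> a" by blast
    then show ?thesis
    proof cases
      case 1 then show ?thesis by (intro exI[of _ a]) (simp add: turn_def a)
    next
      case 2 then show ?thesis by (intro exI[of _ 0]) (simp add: turn_def a)
    next
      case 3 then show ?thesis by (intro exI[of _ j]) (simp add: turn_def a)
    qed
  qed
  ultimately show ?thesis unfolding near_def by metis
qed

lemma adjacent_sym: "adjacent d x y \<Longrightarrow> adjacent d y x"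
proof -
  assume "adjacent d x y"
  then obtain a \<sigma> where "a < d" "\<bar>\<sigma>\<bar> = 1" "y = x(a := x a + \<sigma>)" by (auto simp: adjacent_def)
  then have "a < d \<and> \<bar>-\<sigma>\<bar> = 1 \<and> x = y(a := y a + -\<sigma>)" by auto
  then show ?thesis unfolding adjacent_def by blast
qed

text \<open>Along the edge a double cone does not reach beyond the endpoints, and across it its
  width is at most 1/4. It therefore stays within 1/4 of the bounding box of the edge.\<close>

lemma turn_box:
  assumes "w = u(a := u a + \<sigma>)" "\<bar>\<sigma>\<bar> = 1" "x \<in> spindle"
  shows "of_int (min (u j) (w j)) - 1/4 \<le> of_int (u j) + turn a \<sigma> x j"
    and "of_int (u j) + turn a \<sigma> x j \<le> of_int (max (u j) (w j)) + 1/4"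
proof -
  note x = spindleD[OF assms(3)]
  have s: "\<sigma> = 1 \<or> \<sigma> = -1" using assms(2) by linarith
  have b: "\<bar>x l\<bar> \<le> 1/4" if "l \<noteq> 0" for l using x(3,4)[OF that] by linarith
  consider "j = a" | "j \<noteq> a" "j = 0" | "j \<noteq> a" "j \<noteq> 0" by blast
  then have "of_int (min (u j) (w j)) - 1/4 \<le> of_int (u j) + turn a \<sigma> x j
     \<and> of_int (u j) + turn a \<sigma> x j \<le> of_int (max (u j) (w j)) + 1/4"
  proof cases
    case 1
    then show ?thesis using s x(1,2) by (auto simp: turn_def assms(1))
  next
    case 2
    then show ?thesis using b[of a] by (auto simp: turn_def assms(1))
  next
    case 3
    then show ?thesis using b[of j] by (auto simp: turn_def assms(1))
  qed
  then show "of_int (min (u j) (w j)) - 1/4 \<le> of_int (u j) + turn a \<sigma> x j"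
    and "of_int (u j) + turn a \<sigma> x j \<le> of_int (max (u j) (w j)) + 1/4" by auto
qed

text \<open>Recovers axis and sign from the vertices alone. Copies along such edges are
  translations, since \<open>turn 0 1\<close> is the identity.\<close>

lemma straight_edge:
  fixes u w :: "nat \<Rightarrow> int"
  assumes "w = u(a := u a + \<sigma>)" "w 0 = u 0 + 1"
  shows "a = 0" "\<sigma> = 1"
  using fun_cong[OF assms(1), of 0] assms(2) by (auto split: if_splits)

section \<open>The self-similar curve\<close>

text \<open>The lattice path that replaces an edge. Assumption \<open>place\<close> keeps the copies
  inside the double cone and so passes from one stage to the next. The first and last edges run
  along axis \<open>0\<close>, and by \<open>away_start\<close> and \<open>away_end\<close> all
  other copies keep distance one from the levels of both endpoints; this controls the curve near its
  ends.\<close>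

locale generator =
  fixes d m N :: nat and v :: "nat \<Rightarrow> nat \<Rightarrow> int" and ax :: "nat \<Rightarrow> nat" and sg :: "nat \<Rightarrow> int"
  assumes d_pos: "d > 0" and m_pos: "m > 0" and N_ge: "N \<ge> 2"
    and ax_less: "i < N \<Longrightarrow> ax i < d"
    and sg_abs: "i < N \<Longrightarrow> \<bar>sg i\<bar> = 1"
    and step: "i < N \<Longrightarrow> v (Suc i) = (v i)(ax i := v i (ax i) + sg i)"
    and inj: "inj_on v {..N}"
    and v_first: "v 0 = (\<lambda>j. 0)" "v (Suc 0) = (\<lambda>j. 0)(0 := 1)"
    and v_last: "v N = (\<lambda>j. 0)(0 := int m)" "v (N - Suc 0) = (\<lambda>j. 0)(0 := int m - 1)"
    and place: "i < N \<Longrightarrow> x \<in> spindle \<Longrightarrow>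
          (\<lambda>j. (of_int (v i j) + turn (ax i) (sg i) x j) / m) \<in> spindle"
    and away_start: "0 < i \<Longrightarrow> i < N \<Longrightarrow> x \<in> spindle \<Longrightarrow>
          1 \<le> of_int (v i 0) + turn (ax i) (sg i) x 0"
    and away_end: "Suc i < N \<Longrightarrow> x \<in> spindle \<Longrightarrow>
          of_int (v i 0) + turn (ax i) (sg i) x 0 \<le> real m - 1"
begin

definition copy :: "nat \<Rightarrow> (nat \<Rightarrow> real) \<Rightarrow> nat \<Rightarrow> real" where
  "copy i x = (\<lambda>j. of_int (v i j) + turn (ax i) (sg i) x j)"

lemma N_pos: "N > 0" using N_ge by simp

lemma near_copy: "i < N \<Longrightarrow> near r (copy i x) (copy i y) \<longleftrightarrow> near r x y"
  using near_turn[OF sg_abs, of i r "ax i" x y] by (simp add: near_def copy_def)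

lemma copy_zero: "copy i (\<lambda>j. 0) = (\<lambda>j. of_int (v i j))"
  by (auto simp: copy_def turn_def)

lemma copy_unit: "i < N \<Longrightarrow> copy i unit_vec = (\<lambda>j. of_int (v (Suc i) j))"
  by (auto simp: copy_def turn_def step unit_vec_def)

lemma straight_first: "copy 0 x = x"
proof -
  have "ax 0 = 0" "sg 0 = 1"
    using straight_edge[OF step[of 0]] N_pos by (auto simp: v_first)
  then show ?thesis by (auto simp: copy_def turn_def v_first)
qed

lemma straight_last: "copy (N - 1) x = (\<lambda>j. x j + (if j = 0 then real m - 1 else 0))"
proof -
  have "ax (N - Suc 0) = 0" "sg (N - Suc 0) = 1"
    using straight_edge[OF step[of "N - Suc 0"]] N_pos by (auto simp: v_last)
  then show ?thesis by (auto simp: copy_def turn_def v_last)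
qed

section \<open>Mutual distance of the copies\<close>

lemma copy_box:
  assumes "i < N" "x \<in> spindle"
  shows "of_int (min (v i j) (v (Suc i) j)) - 1/4 \<le> copy i x j"
    and "copy i x j \<le> of_int (max (v i j) (v (Suc i) j)) + 1/4"
  using turn_box[OF step sg_abs assms(2)] assms(1) by (auto simp only: copy_def)

text \<open>The bounding box of a unit edge is degenerate in every direction but
  \<open>ax i\<close>, where it has length one; its only lattice points are the two
  endpoints.\<close>

lemma lattice_point_on_edge:
  assumes "i < N" "\<And>j. min (v i j) (v (Suc i) j) \<le> z j" "\<And>j. z j \<le> max (v i j) (v (Suc i) j)"
  shows "z = v i \<or> z = v (Suc i)"
proof -
  have o: "z j = v i j" if "j \<noteq> ax i" for j
    using assms(2,3)[of j] that by (auto simp: step[OF assms(1)])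
  have "z (ax i) = v i (ax i) \<or> z (ax i) = v (Suc i) (ax i)"
    using assms(2,3)[of "ax i"] sg_abs[OF assms(1)] by (auto simp: step[OF assms(1)])
  then show ?thesis
  proof
    assume "z (ax i) = v i (ax i)"
    then have "z = v i" using o by (intro ext) metis
    then show ?thesis ..
  next
    assume "z (ax i) = v (Suc i) (ax i)"
    then have "z = v (Suc i)" using o by (intro ext) (auto simp: step[OF assms(1)])
    then show ?thesis ..
  qed
qed

text \<open>If the two boxes overlapped in every coordinate, the coordinatewise maximum of their
  lower corners would be a lattice point in both, hence a common endpoint of two non-consecutive
  edges of a simple path.\<close>

lemma edges_separated:
  assumes "Suc i < l" "l < N"
  shows "\<exists>j. max (v i j) (v (Suc i) j) < min (v l j) (v (Suc l) j) \<or>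
             max (v l j) (v (Suc l) j) < min (v i j) (v (Suc i) j)"
proof (rule ccontr)
  assume n: "\<not> ?thesis"
  define z where "z = (\<lambda>j. max (min (v i j) (v (Suc i) j)) (min (v l j) (v (Suc l) j)))"
  have z: "min (v i j) (v (Suc i) j) \<le> z j" "z j \<le> max (v i j) (v (Suc i) j)"
    "min (v l j) (v (Suc l) j) \<le> z j" "z j \<le> max (v l j) (v (Suc l) j)" for j
    using n[simplified not_ex de_Morgan_disj not_less, rule_format, of j] unfolding z_def
    by linarith+
  have "z = v i \<or> z = v (Suc i)" "z = v l \<or> z = v (Suc l)"
    using lattice_point_on_edge z assms by auto
  moreover have "v a \<noteq> v b" if "a \<le> Suc i" "l \<le> b" "b \<le> Suc l" for a b
    using inj_onD[OF inj, of a b] that assms by auto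
  ultimately show False using assms(1)
    by (metis le_refl le_SucI)
qed

text \<open>Integral boxes that are disjoint in some coordinate have a gap of at least 1 there; each
  cone uses up at most 1/4 of it.\<close>

lemma far_copies:
  assumes "Suc i < l" "l < N" "x \<in> spindle" "y \<in> spindle" "near r (copy i x) (copy l y)"
  shows "1 \<le> 2 * r"
proof -
  obtain j where "max (v i j) (v (Suc i) j) < min (v l j) (v (Suc l) j) \<or>
             max (v l j) (v (Suc l) j) < min (v i j) (v (Suc i) j)"
    using edges_separated assms by blast
  then have "of_int (max (v i j) (v (Suc i) j)) + 1 \<le> real_of_int (min (v l j) (v (Suc l) j)) \<or>
             of_int (max (v l j) (v (Suc l) j)) + 1 \<le> real_of_int (min (v i j) (v (Suc i) j))"
    by linarith
  then show ?thesis
    using copy_box[of i x j] copy_box[of l y j] nearD[OF assms(5), of j] assms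
    by linarith
qed

text \<open>Both cones have a tip at the common vertex \<open>?w\<close>, and \<open>1 - x 0\<close>
  and \<open>y 0\<close> measure how far the points are from it. Since the cones meet at an angle,
  two points that are close to each other are both close to the tip.\<close>

lemma adjacent_copies:
  assumes "Suc i < N" "x \<in> spindle" "y \<in> spindle" "near r (copy i x) (copy (Suc i) y)"
  shows "1 - x 0 \<le> 2 * r" "y 0 \<le> 2 * r"
proof -
  let ?w = "\<lambda>j. real_of_int (v (Suc i) j)"
  let ?a = "ax i" and ?b = "ax (Suc i)"
  note x = spindleD[OF assms(2)] and y = spindleD[OF assms(3)]
  have sa: "sg i = 1 \<or> sg i = -1" using sg_abs[of i] assms(1) by linarith
  have sb: "sg (Suc i) = 1 \<or> sg (Suc i) = -1" using sg_abs[of "Suc i"] assms(1) by linarith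
  have xa: "copy i x ?a = ?w ?a - sg i * (1 - x 0)"
    using assms(1) by (auto simp: copy_def turn_def step[of i] algebra_simps)
  have xo: "2 * \<bar>copy i x j - ?w j\<bar> \<le> 1 - x 0" if "j \<noteq> ?a" for j
    using that x(4)[of "ax i"] x(4)[of j] assms(1) by (auto simp: copy_def turn_def step[of i])
  have yb: "copy (Suc i) y ?b = ?w ?b + sg (Suc i) * y 0"
    by (auto simp: copy_def turn_def)
  have yo: "2 * \<bar>copy (Suc i) y j - ?w j\<bar> \<le> y 0" if "j \<noteq> ?b" for j
    using that y(3)[of "ax (Suc i)"] y(3)[of j] by (auto simp: copy_def turn_def)
  have "1 - x 0 \<le> 2 * r \<and> y 0 \<le> 2 * r"
  proof (cases "?a = ?b")
    case True
    \<comment> \<open>A reversal would lead back to \<open>v i\<close>, against simplicity. The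
      edges thus continue straight, and the distances to the common vertex add up.\<close>
    have "sg (Suc i) \<noteq> - sg i"
    proof
      assume "sg (Suc i) = - sg i"
      then have "v (Suc (Suc i)) = v i" using True assms(1) by (auto simp: step)
      then show False using inj_onD[OF inj, of "Suc (Suc i)" i] assms(1) by auto
    qed
    then have "sg (Suc i) = sg i" using sa sb by auto
    then show ?thesis using xa yb True nearD[OF assms(4), of ?a] sa x(2) y(1) by auto
  next
    case False
    have "2 * (1 - x 0) - y 0 \<le> 2 * r"
      using sa xa yo[OF False] nearD[OF assms(4), of ?a] by (elim disjE; simp) (smt (verit))+
    moreover have "2 * y 0 - (1 - x 0) \<le> 2 * r"
      using sb yb xo[OF False[symmetric]] nearD[OF assms(4), of ?b] by (elim disjE; simp) (smt (verit))+
    \<comment> \<open>Twice one inequality plus the other eliminates \<open>y 0\<close> or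
      \<open>1 - x 0\<close> respectively.\<close>
    ultimately show ?thesis by auto
  qed
  then show "1 - x 0 \<le> 2 * r" "y 0 \<le> 2 * r" by auto
qed

section \<open>The stages of the curve\<close>

text \<open>The \<open>t\<close>-th vertex of the \<open>k\<close>-th stage, for \<open>t\<close> up
  to \<open>N ^ k\<close>. A vertex shared by two copies is computed as the start of the later one.
  At the very last vertex the index is \<open>N\<close>; there the origin is copied, which gives
  \<open>v N\<close> for any value of \<open>ax N\<close> and \<open>sg N\<close>.\<close>

primrec curve :: "nat \<Rightarrow> nat \<Rightarrow> nat \<Rightarrow> real" where
  "curve 0 t = (\<lambda>j. if j = 0 \<and> t > 0 then 1 else 0)"
| "curve (Suc k) t = (\<lambda>j. copy (t div N ^ k) (curve k (t mod N ^ k)) j / m)"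

lemma curve_start: "curve k 0 = (\<lambda>j. 0)"
proof (induction k)
  case (Suc k)
  then show ?case by (simp add: copy_zero v_first)
qed auto

lemma curve_end: "curve k (N ^ k) = unit_vec"
proof (cases k)
  case (Suc l)
  then show ?thesis using N_pos m_pos
    by (auto simp: curve_start copy_zero v_last unit_vec_def)
qed (auto simp: unit_vec_def)

text \<open>Index of the copy containing the \<open>t\<close>-th vertex of stage \<open>k + 1\<close>. The minimum puts the endpoint
  into the last copy.\<close>

definition part :: "nat \<Rightarrow> nat \<Rightarrow> nat" where
  "part k t = min (t div N ^ k) (N - 1)"

lemma part_less: "part k t < N" using N_pos by (auto simp: part_def)

lemma part_mono: "s \<le> t \<Longrightarrow> part k s \<le> part k t"
  unfolding part_def by (meson div_le_mono min.mono order_refl)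

text \<open>Holds at the right end as well, because copy \<open>i\<close> ends where copy
  \<open>i + 1\<close> starts. A shared vertex may thus be assigned to either copy.\<close>

lemma curve_copy:
  assumes "i < N" "i * N ^ k \<le> t" "t \<le> Suc i * N ^ k"
  shows "curve (Suc k) t = (\<lambda>j. copy i (curve k (t - i * N ^ k)) j / m)"
proof (cases "t = Suc i * N ^ k")
  case True
  have "t div N ^ k = Suc i" "t mod N ^ k = 0" using True N_pos by auto
  then have "copy (t div N ^ k) (curve k (t mod N ^ k)) = copy i (curve k (t - i * N ^ k))"
    using assms(1) True by (simp add: curve_start copy_zero curve_end copy_unit)
  then show ?thesis by simp
next
  case False
  have "t div N ^ k = i" using assms False
    by (intro div_nat_eqI) (auto simp: mult.commute)
  moreover have "t mod N ^ k = t - i * N ^ k"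
    using calculation by (metis minus_div_mult_eq_mod)
  ultimately show ?thesis by simp
qed

lemma part_bounds:
  assumes "t \<le> N ^ Suc k"
  shows "part k t * N ^ k \<le> t" "t \<le> Suc (part k t) * N ^ k"
proof -
  have "part k t \<le> t div N ^ k" by (simp add: part_def)
  then show "part k t * N ^ k \<le> t"
    by (meson div_times_less_eq_dividend le_trans mult_le_mono1)
  show "t \<le> Suc (part k t) * N ^ k"
  proof (cases "t div N ^ k \<le> N - 1")
    case True
    then have "part k t = t div N ^ k" by (simp add: part_def)
    then show ?thesis using N_pos
      by (metis dividend_less_div_times less_imp_le mult_Suc zero_less_power)
  next
    case False
    then have "Suc (part k t) = N" using N_pos by (simp add: part_def)
    then show ?thesis using assms by simp
  qed
qed

lemma curve_part:
  assumes "t \<le> N ^ Suc k"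
  shows "curve (Suc k) t = (\<lambda>j. copy (part k t) (curve k (t - part k t * N ^ k)) j / m)"
    "t - part k t * N ^ k \<le> N ^ k"
  using curve_copy[OF part_less part_bounds[OF assms]] part_bounds[OF assms] by auto

lemma curve_spindle: "t \<le> N ^ k \<Longrightarrow> curve k t \<in> spindle"
proof (induction k arbitrary: t)
  case 0
  then show ?case by (auto simp: spindle_def)
next
  case (Suc k)
  show ?case
    using place[OF part_less Suc.IH[OF curve_part(2)[OF Suc.prems]], of k t]
    by (simp only: curve_part(1)[OF Suc.prems] copy_def)
qed

lemma curve_support: "t \<le> N ^ k \<Longrightarrow> j \<ge> d \<Longrightarrow> curve k t j = 0"
proof (induction k arbitrary: t)
  case 0
  then show ?case using d_pos by auto
next
  case (Suc k)
  have v: "v i j = 0" if "i \<le> N" for i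
    using that
  proof (induction i)
    case (Suc i)
    then show ?case using step[of i] ax_less[of i] \<open>d \<le> j\<close> by auto
  qed (simp add: v_first)
  have "j \<noteq> ax (part k t)" "j \<noteq> 0" using ax_less[OF part_less, of k t] Suc.prems d_pos by auto
  then show ?case
    using Suc.IH[OF curve_part(2)[OF Suc.prems(1)] Suc.prems(2)] v[of "part k t"] part_less[of k t]
    by (simp only: curve_part(1)[OF Suc.prems(1)] copy_def turn_def) simp
qed

lemma curve_step:
  "t < N ^ k \<Longrightarrow> \<exists>a<d. \<exists>s. \<bar>s\<bar> = 1 / m ^ k \<and> curve k (Suc t) = (curve k t)(a := curve k t a + s)"
proof (induction k arbitrary: t)
  case 0
  then show ?case using d_pos by (intro exI[of _ 0] conjI exI[of _ 1]) auto
next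
  case (Suc k)
  define i where "i = t div N ^ k"
  define u where "u = t - i * N ^ k"
  have N: "N ^ k > 0" using N_pos by simp
  have i: "i < N" using Suc.prems by (simp add: i_def less_mult_imp_div_less)
  have t: "i * N ^ k \<le> t" "t < Suc i * N ^ k"
    using N by (auto simp: i_def dividend_less_div_times) 
  have u: "u < N ^ k" "Suc t - i * N ^ k = Suc u" using t by (auto simp: u_def)
  obtain a s where as: "a < d" "\<bar>s\<bar> = 1 / m ^ k" "curve k (Suc u) = (curve k u)(a := curve k u a + s)"
    using Suc.IH[OF u(1)] by blast
  have c1: "curve (Suc k) t = (\<lambda>j. copy i (curve k u) j / m)"
    using curve_copy[OF i t(1)] t(2) by (simp add: u_def)
  have c2: "curve (Suc k) (Suc t) = (\<lambda>j. copy i (curve k (Suc u)) j / m)"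
    using curve_copy[OF i, of k "Suc t"] t u(2) by simp
  \<comment> \<open>The rotation exchanges axis \<open>0\<close> with \<open>ax i\<close>; only a
    change along the original axis \<open>0\<close> picks up the sign.\<close>
  define b where "b = (if a = 0 then ax i else if a = ax i then 0 else a)"
  define s' where "s' = (if a = 0 then sg i * s else s) / m"
  have "\<bar>s'\<bar> = 1 / m ^ Suc k"
    using as(2) sg_abs[OF i] by (auto simp: s'_def abs_mult simp flip: of_int_abs)
  moreover have "curve (Suc k) (Suc t) = (curve (Suc k) t)(b := curve (Suc k) t b + s')"
    unfolding c1 c2 as(3) copy_def turn_def b_def s'_def
    by (auto simp: fun_eq_iff add_divide_distrib distrib_left)
  moreover have "b < d" using as(1) ax_less[OF i] d_pos by (auto simp: b_def)
  ultimately show ?case by blast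
qed

text \<open>Seen from either end of the curve the turning constant is \<open>m\<close> at every level. This
  is what keeps the constant of \<open>curve_turning\<close> below from growing with \<open>k\<close>.\<close>

lemma curve_progress:
  "s \<le> t \<Longrightarrow> t \<le> N ^ k \<Longrightarrow>
    curve k s 0 \<le> m * curve k t 0 \<and> 1 - curve k t 0 \<le> m * (1 - curve k s 0)"
proof (induction k arbitrary: s t)
  case 0
  then show ?case using m_pos by auto
next
  case (Suc k)
  have t: "t \<le> N ^ Suc k" and s: "s \<le> N ^ Suc k" using Suc.prems by auto
  note cs = curve_spindle[OF s] curve_spindle[OF t]
  note b = spindleD(1,2)[OF cs(1)] spindleD(1,2)[OF cs(2)]
  note ps = curve_spindle[OF curve_part(2)[OF s]] and pt = curve_spindle[OF curve_part(2)[OF t]]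
  have "curve (Suc k) s 0 \<le> m * curve (Suc k) t 0"
  proof (cases "part k t = 0")
    case True
    \<comment> \<open>Both vertices lie in the first copy, which is not rotated; the factor
      \<open>1 / m\<close> cancels and the constant is inherited unchanged.\<close>
    then have "part k s = 0" using part_mono[OF Suc.prems(1), of k] by simp
    then have "curve (Suc k) s = (\<lambda>j. curve k s j / m)" "s \<le> N ^ k"
      "curve (Suc k) t = (\<lambda>j. curve k t j / m)" "t \<le> N ^ k"
      using True curve_part[OF s] curve_part[OF t] by (simp_all only: straight_first) auto
    then show ?thesis using Suc.IH[OF Suc.prems(1)] m_pos by (simp add: field_simps)
  next
    case False
    \<comment> \<open>Outside the first copy the level is at least \<open>1 / m\<close>, and the
      level of \<open>s\<close> is at most 1 anyway.\<close>
    then have "1 \<le> m * curve (Suc k) t 0"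
      using away_start[OF _ part_less pt] m_pos
      by (simp only: curve_part(1)[OF t] copy_def) simp
    then show ?thesis using b by linarith
  qed
  moreover have "1 - curve (Suc k) t 0 \<le> m * (1 - curve (Suc k) s 0)"
  proof (cases "Suc (part k s) = N")
    case True
    then have p: "part k s = N - 1" "part k t = N - 1"
      using part_mono[OF Suc.prems(1), of k] part_less[of k t] by auto
    let ?o = "(N - 1) * N ^ k"
    have e: "curve (Suc k) s 0 = (curve k (s - ?o) 0 + (real m - 1)) / m"
      "curve (Suc k) t 0 = (curve k (t - ?o) 0 + (real m - 1)) / m" "t - ?o \<le> N ^ k"
      using p curve_part[OF s] curve_part[OF t] by (simp_all only: straight_last) auto
    have "1 - curve k (t - ?o) 0 \<le> m * (1 - curve k (s - ?o) 0)"
      using Suc.IH[of "s - ?o" "t - ?o"] Suc.prems e(3) by auto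
    then have "m * (1 - curve k (t - ?o) 0) \<le> m * (m * (1 - curve k (s - ?o) 0))"
      by (rule mult_left_mono) simp
    then show ?thesis using m_pos unfolding e(1,2) by (simp add: field_simps)
  next
    case False
    then have "m * curve (Suc k) s 0 \<le> real m - 1"
      using away_end[OF _ ps] m_pos part_less[of k s]
      by (simp only: curve_part(1)[OF s] copy_def) simp
    then have "1 \<le> m * (1 - curve (Suc k) s 0)" by (simp add: algebra_simps)
    then show ?thesis using b by linarith
  qed
  ultimately show ?case ..
qed

text \<open>If \<open>s\<close> and \<open>u\<close> lie in one copy, the claim is inherited at
  scale \<open>m\<close>. In consecutive copies both are close to the common vertex, and
  \<open>curve_progress\<close> carries this over to \<open>t\<close>; the induction hypothesis is
  not applied there, so the constant does not accumulate. In copies further apart \<open>r\<close>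
  is at least \<open>1 / (2 * m)\<close>, while the whole curve has diameter at most 1.\<close>

lemma curve_turning:
  "s \<le> t \<Longrightarrow> t \<le> u \<Longrightarrow> u \<le> N ^ k \<Longrightarrow> near r (curve k s) (curve k u) \<Longrightarrow>
    near ((2 * real m + 2) * r) (curve k s) (curve k t)"
proof (induction k arbitrary: s t u r)
  case 0
  then have "s = t \<or> t = u" by auto
  then show ?case
  proof
    assume "s = t"
    then show ?thesis using near_nonneg[OF 0(4)] by (simp add: near_def)
  next
    assume "t = u"
    then show ?thesis using 0(4) near_nonneg[OF 0(4)]
      by (auto elim!: near_mono simp: mult_le_cancel_right1)
  qed
next
  case (Suc k)
  have u: "u \<le> N ^ Suc k" and s: "s \<le> N ^ Suc k" and t: "t \<le> N ^ Suc k" using Suc.prems by auto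
  define R where "R = m * r"
  have r: "r \<ge> 0" using near_nonneg Suc.prems by blast
  define i l where "i = part k s" and "l = part k u"
  define x z where "x = curve k (s - i * N ^ k)" and "z = curve k (u - l * N ^ k)"
  have mm: "real m > 0" using m_pos by simp
  have cs: "curve (Suc k) s = (\<lambda>j. copy i x j / m)" and cu: "curve (Suc k) u = (\<lambda>j. copy l z j / m)"
    using curve_part[OF s] curve_part[OF u] by (simp_all only: x_def z_def i_def l_def)
  have xs: "x \<in> spindle" "z \<in> spindle"
    using curve_spindle curve_part[OF s] curve_part[OF u] by (simp_all add: x_def z_def i_def l_def)
  have il: "i \<le> l" "l < N" using part_mono part_less Suc.prems by (auto simp: i_def l_def)
  have si: "i * N ^ k \<le> s" using part_bounds[OF s] by (simp add: i_def)
  have ul: "u \<le> Suc l * N ^ k" using part_bounds[OF u] by (simp add: l_def)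
  have nr: "near R (copy i x) (copy l z)"
    using Suc.prems(4) mm unfolding cs cu by (simp add: near_divide R_def)
  have R0: "0 \<le> R" using near_nonneg[OF nr] .
  consider "l = i" | "l = Suc i" | "Suc i < l" using il by linarith
  then show ?case
  proof cases
    case 1
    define y where "y = curve k (t - i * N ^ k)"
    have ct: "curve (Suc k) t = (\<lambda>j. copy i y j / m)"
      using curve_copy[of i k t] Suc.prems si ul il 1 by (simp add: y_def)
    have "near ((2 * real m + 2) * R) x y"
      unfolding x_def y_def
    proof (rule Suc.IH)
      show "near R (curve k (s - i * N ^ k)) (curve k (u - i * N ^ k))"
        using nr 1 il near_copy by (simp add: x_def z_def)
    qed (use Suc.prems ul 1 in auto)
    then have "near ((2 * real m + 2) * R) (copy i x) (copy i y)" using near_copy il by simp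
    then show ?thesis unfolding cs ct near_divide[OF mm] by (simp add: R_def mult.left_commute)
  next
    case 2
    let ?w = "\<lambda>j. real_of_int (v (Suc i) j)"
    note ac = adjacent_copies[of i, OF _ xs nr[unfolded 2]]
    have a1: "1 - x 0 \<le> 2 * R" and a2: "z 0 \<le> 2 * R" using ac il 2 by auto
    have pw: "near (1 - x 0) (copy i x) ?w"
      using near_copy[of i "1 - x 0" x unit_vec] spindle_near_unit[OF xs(1)] copy_unit[of i] il 2
      by simp
    show ?thesis
    proof (cases "t \<le> Suc i * N ^ k")
      case True
      define y where "y = curve k (t - i * N ^ k)"
      have ct: "curve (Suc k) t = (\<lambda>j. copy i y j / m)"
        using curve_copy[of i k t] Suc.prems si True il 2 by (simp add: y_def)
      have ys: "y \<in> spindle" unfolding y_def using True by (intro curve_spindle) auto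
      have "1 - y 0 \<le> m * (1 - x 0)"
        using curve_progress[of "s - i * N ^ k" "t - i * N ^ k" k] Suc.prems True
        by (auto simp: x_def y_def)
      also have "\<dots> \<le> m * (2 * R)" using a1 by (intro mult_left_mono) auto
      finally have y: "1 - y 0 \<le> m * (2 * R)" .
      have "near (1 - y 0) (copy i y) ?w"
        using near_copy[of i "1 - y 0" y unit_vec] spindle_near_unit[OF ys] copy_unit[of i] il 2
        by simp
      \<comment> \<open>The detour through the common vertex costs \<open>2 * R\<close> on the side
        of \<open>s\<close> and \<open>m * (2 * R)\<close> on the side of \<open>t\<close>, which is
        the constant claimed.\<close>
      from near_trans[OF pw near_sym[OF this]]
      have "near ((2 * real m + 2) * R) (copy i x) (copy i y)"
        by (rule near_mono) (use y a1 in \<open>simp add: algebra_simps\<close>)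
      then show ?thesis unfolding cs ct near_divide[OF mm] by (simp add: R_def mult.left_commute)
    next
      case False
      define y where "y = curve k (t - l * N ^ k)"
      have ct: "curve (Suc k) t = (\<lambda>j. copy l y j / m)"
        using curve_copy[of l k t] Suc.prems ul False il 2 by (simp add: y_def)
      have tu: "t - l * N ^ k \<le> u - l * N ^ k" "u - l * N ^ k \<le> N ^ k" using Suc.prems ul by auto
      have ys: "y \<in> spindle" unfolding y_def using tu by (intro curve_spindle) auto
      have "y 0 \<le> m * z 0"
        using curve_progress[OF tu] by (auto simp: z_def y_def)
      also have "\<dots> \<le> m * (2 * R)" using a2 by (intro mult_left_mono) auto
      finally have y: "y 0 \<le> m * (2 * R)" .
      have "near (y 0) (copy l y) ?w"
        using near_copy[of l "y 0" y "\<lambda>j. 0"] spindle_near_zero[OF ys] copy_zero[of l] il 2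
        by simp
      from near_trans[OF pw near_sym[OF this]]
      have "near ((2 * real m + 2) * R) (copy i x) (copy l y)"
        by (rule near_mono) (use y a1 in \<open>simp add: algebra_simps\<close>)
      then show ?thesis unfolding cs ct near_divide[OF mm] by (simp add: R_def mult.left_commute)
    qed
  next
    case 3
    have "1 \<le> 2 * R" using far_copies[OF 3 il(2) xs nr] .
    then have "1 \<le> (2 * real m + 2) * r" using r by (simp add: R_def algebra_simps)
    then show ?thesis
      using near_mono spindle_near[OF curve_spindle[OF s] curve_spindle[OF t]] by blast
  qed
qed

end

section \<open>Prolonging the curve to a chain\<close>

lemma edist_le_near: "near r x y \<Longrightarrow> edist d x y \<le> real d * r"
proof -
  assume n: "near r x y"
  have "edist d x y \<le> (\<Sum>i<d. \<bar>x i - y i\<bar>)"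
    unfolding edist_def by (rule L2_set_le_sum_abs)
  also have "\<dots> \<le> (\<Sum>i<d. r)" using nearD[OF n] by (intro sum_mono) auto
  finally show ?thesis by simp
qed

lemma near_edist:
  assumes "\<And>j. j \<ge> d \<Longrightarrow> x j = 0" "\<And>j. j \<ge> d \<Longrightarrow> y j = 0"
  shows "near (edist d x y) x y"
  unfolding near_def
proof
  fix j
  show "\<bar>x j - y j\<bar> \<le> edist d x y"
  proof (cases "j < d")
    case True
    have "\<bar>x j - y j\<bar> \<le> L2_set (\<lambda>i. \<bar>x i - y i\<bar>) {..<d}"
      using True by (intro member_le_L2_set) auto
    then show ?thesis by (simp add: edist_def L2_set_def)
  qed (use assms in \<open>simp add: edist_def\<close>)
qed

lemma edist_single:
  assumes "a < d" "y = x(a := x a + s)"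
  shows "edist d x y = \<bar>s\<bar>"
proof -
  have "(\<Sum>i<d. (x i - y i)\<^sup>2) = (\<Sum>i<d. if i = a then s\<^sup>2 else 0)"
    using assms by (intro sum.cong) auto
  then show ?thesis using assms(1) by (simp add: edist_def L2_set_def)
qed

lemma axis_parallel_segment_single:
  "a < d \<Longrightarrow> s \<noteq> 0 \<Longrightarrow> y = x(a := x a + s) \<Longrightarrow> axis_parallel_segment d x y"
  by (auto simp: axis_parallel_segment_def)

context generator
begin

text \<open>The curve is prolonged by collinear points beyond its endpoint, so that the number of
  vertices becomes arbitrary.\<close>

definition prolonged :: "nat \<Rightarrow> nat \<Rightarrow> nat \<Rightarrow> nat \<Rightarrow> real" where
  "prolonged k n t =
     (if t \<le> N ^ k then curve k t else (\<lambda>j. (1 + real (t - N ^ k) / n) * unit_vec j))"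

lemma prolonged_beyond:
  "t \<ge> N ^ k \<Longrightarrow> prolonged k n t = (\<lambda>j. (1 + real (t - N ^ k) / n) * unit_vec j)"
  by (cases "t = N ^ k") (auto simp: prolonged_def curve_end)

lemma prolonged_support: "j \<ge> d \<Longrightarrow> prolonged k n t j = 0"
  using d_pos curve_support[of t k j] by (auto simp: prolonged_def unit_vec_def)

lemma prolonged_step:
  assumes "n > 0"
  shows "\<exists>a<d. \<exists>s. s \<noteq> 0 \<and> (t < N ^ k \<longrightarrow> \<bar>s\<bar> = 1 / m ^ k) \<and>
    prolonged k n (Suc t) = (prolonged k n t)(a := prolonged k n t a + s)"
proof (cases "t < N ^ k")
  case True
  obtain a s where "a < d" "\<bar>s\<bar> = 1 / m ^ k" "curve k (Suc t) = (curve k t)(a := curve k t a + s)"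
    using curve_step[OF True] by blast
  then show ?thesis using True m_pos
    by (intro exI[of _ a] conjI exI[of _ s]) (auto simp: prolonged_def)
next
  case False
  then have "prolonged k n (Suc t) = (prolonged k n t)(0 := prolonged k n t 0 + 1 / n)"
    using assms by (auto simp: prolonged_beyond Suc_diff_le unit_vec_def fun_eq_iff add_divide_distrib)
  then show ?thesis using False d_pos assms
    by (intro exI[of _ 0] conjI exI[of _ "1 / n"]) auto
qed

text \<open>Vertices beyond the curve move monotonically along axis \<open>0\<close>, so a subarc
  ending there can be cut back to an earlier such vertex, in particular to the endpoint of the
  curve, without increasing the distance of its ends. The rest is
  \<open>curve_turning\<close>.\<close>

lemma prolonged_turning:
  assumes "s \<le> t" "t \<le> u" "n > 0" "near r (prolonged k n s) (prolonged k n u)"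
  shows "near ((2 * real m + 2) * r) (prolonged k n s) (prolonged k n t)"
proof -
  let ?p = "prolonged k n"
  have r: "0 \<le> r" "r \<le> (2 * real m + 2) * r"
    using near_nonneg[OF assms(4)] by (auto simp: mult_le_cancel_right1)
  have between: "near r' (?p a) (?p b)" if "near r' (?p a) (?p c)" "a \<le> b" "b \<le> c" "N ^ k \<le> b"
    for r' a b c
    unfolding near_def
  proof
    fix j
    have bc: "?p b = (\<lambda>j. (1 + real (b - N ^ k) / n) * unit_vec j)"
      "?p c = (\<lambda>j. (1 + real (c - N ^ k) / n) * unit_vec j)"
      using that by (auto simp: prolonged_beyond)
    have m: "?p b 0 \<le> ?p c 0" using that assms(3) unfolding bc
      by (auto simp: unit_vec_def divide_right_mono)
    have "?p a 0 \<le> ?p b 0"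
    proof (cases "a \<le> N ^ k")
      case True
      have "?p a 0 \<le> 1" using spindleD(2)[OF curve_spindle[OF True]] True by (simp add: prolonged_def)
      also have "1 \<le> ?p b 0" unfolding bc by (simp add: unit_vec_def)
      finally show ?thesis .
    next
      case False
      then show ?thesis using that assms(3)
        by (auto simp: prolonged_beyond unit_vec_def divide_right_mono)
    qed
    with m show "\<bar>?p a j - ?p b j\<bar> \<le> r'"
      using nearD[OF that(1), of j] by (cases "j = 0") (auto simp: bc unit_vec_def)
  qed
  consider "u \<le> N ^ k" | "N ^ k \<le> t" | "t < N ^ k" "N ^ k < u" by linarith
  then show ?thesis
  proof cases
    case 1
    then show ?thesis using curve_turning[of s t u k r] assms by (simp add: prolonged_def)
  next
    case 2
    then show ?thesis using between[OF assms(4,1,2)] near_mono r(2) by blast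
  next
    case 3
    then have "near r (?p s) (?p (N ^ k))" using between[OF assms(4), of "N ^ k"] assms by simp
    then show ?thesis using curve_turning[of s t "N ^ k" k r] 3 assms by (simp add: prolonged_def)
  qed
qed

text \<open>If the outer points have Euclidean distance \<open>r\<close>, the middle one is within
  \<open>(2 * m + 2) * r\<close> of the first and \<open>(2 * m + 3) * r\<close> of the last in the
  maximum norm; returning to the Euclidean norm costs the factor \<open>d\<close>. For the stretch
  factor only the \<open>N ^ k\<close> edges of the curve are counted, each of length
  \<open>1 / m ^ k\<close>.\<close>

lemma prolonged_chain:
  fixes c :: real
  assumes n: "N ^ k < n" and c: "c \<ge> (4 * real m + 5) * d"
  shows "\<exists>P. length P = n \<and> c_chain d c P \<and> axis_parallel d P \<and>
    stretch_factor d P \<ge> (real N / m) ^ k / 2"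
proof -
  let ?p = "prolonged k n"
  define P where "P = map ?p [0..<n]"
  have "N ^ k > 0" using N_pos by simp
  then have n0: "n > 0" "n \<ge> 2" using n by linarith+
  have nth: "P ! i = ?p i" if "i < n" for i
    using that by (auto simp: P_def)
  have len: "length P = n" by (simp add: P_def)
  have C: "edist d (?p a) (?p b) + edist d (?p b) (?p e) \<le> c * edist d (?p a) (?p e)"
    if "a < b" "b < e" for a b e
  proof -
    define r where "r = edist d (?p a) (?p e)"
    have r: "near r (?p a) (?p e)" unfolding r_def by (intro near_edist prolonged_support)
    have ab: "near ((2 * real m + 2) * r) (?p a) (?p b)"
      using prolonged_turning[OF _ _ _ r] that n0 by simp
    have be: "near ((2 * real m + 2) * r + r) (?p b) (?p e)"
      using near_trans[OF near_sym[OF ab] r] .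
    have "edist d (?p a) (?p b) + edist d (?p b) (?p e)
      \<le> d * ((2 * real m + 2) * r) + d * ((2 * real m + 2) * r + r)"
      using edist_le_near[OF ab, of d] edist_le_near[OF be, of d] by linarith
    also have "\<dots> = ((4 * real m + 5) * d) * r" by (simp add: algebra_simps)
    also have "\<dots> \<le> c * r" using near_nonneg[OF r] by (intro mult_right_mono c)
    finally show ?thesis by (simp add: r_def)
  qed
  have "1 * 1 \<le> (4 * real m + 5) * d" using d_pos by (intro mult_mono) auto
  then have c1: "1 \<le> c" using c by linarith
  have chain: "c_chain d c P"
    unfolding c_chain_def polygonal_chain_def
  proof (intro conjI allI impI c1)
    show "P \<noteq> []" using n0 len by auto
    show "set P \<subseteq> topspace (Euclidean_space d)"
      using prolonged_support by (auto simp: P_def topspace_Euclidean_space)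
    fix a b e assume "a < b" "b < e" "e < length P"
    then show "edist d (P ! a) (P ! b) + edist d (P ! b) (P ! e) \<le> c * edist d (P ! a) (P ! e)"
      using C[of a b e] nth[of a] nth[of b] nth[of e] len by simp
  qed
  have par: "axis_parallel d P"
    unfolding axis_parallel_def
  proof (intro allI impI)
    fix i assume i: "Suc i < length P"
    obtain a s where "a < d" "s \<noteq> 0" "?p (Suc i) = (?p i)(a := ?p i a + s)"
      using prolonged_step[OF n0(1)] by blast
    then have "axis_parallel_segment d (?p i) (?p (Suc i))" by (rule axis_parallel_segment_single)
    then show "axis_parallel_segment d (P ! i) (P ! Suc i)"
      using i nth[of i] nth[of "Suc i"] len by simp
  qed
  have "(\<Sum>i<N ^ k. 1 / real m ^ k) \<le> (\<Sum>i<N ^ k. edist d (P ! i) (P ! Suc i))"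
  proof (rule sum_mono)
    fix i assume i: "i \<in> {..<N ^ k}"
    then obtain a s where "a < d" "\<bar>s\<bar> = 1 / m ^ k" "?p (Suc i) = (?p i)(a := ?p i a + s)"
      using prolonged_step[of n i k] n0(1) by auto
    then show "1 / real m ^ k \<le> edist d (P ! i) (P ! Suc i)"
      using edist_single[of a d "?p (Suc i)" "?p i" s] i n by (simp add: nth)
  qed
  also have "\<dots> \<le> (\<Sum>i<length P - 1. edist d (P ! i) (P ! Suc i))"
    using n len by (intro sum_mono2) (auto simp: edist_def)
  finally have L: "(real N / m) ^ k \<le> (\<Sum>i<length P - 1. edist d (P ! i) (P ! Suc i))"
    by (simp add: power_divide)
  \<comment> \<open>The added steps have length \<open>1 / n\<close> and number fewer than
    \<open>n\<close>, so the endpoints are at distance at most 2. This is the source of the factor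
    1/2.\<close>
  define z where "z = 1 + real (n - 1 - N ^ k) / n"
  have "real (n - 1 - N ^ k) \<le> real n" by (rule of_nat_mono) simp
  then have z: "0 < z" "z \<le> 2" using n0 by (simp_all add: z_def add_pos_nonneg divide_le_eq)
  have "hd P = (\<lambda>j. 0)" using n0 by (simp add: P_def hd_map prolonged_def curve_start)
  moreover have "last P = (\<lambda>j. z * unit_vec j)"
    using n0 n by (simp add: P_def last_map z_def prolonged_beyond)
  moreover have "edist d (\<lambda>j. 0) (\<lambda>j. z * unit_vec j) = \<bar>z\<bar>"
    using d_pos by (intro edist_single) (auto simp: unit_vec_def)
  ultimately have D: "edist d (hd P) (last P) = z" using z by simp
  have "(real N / m) ^ k / 2 \<le> (real N / m) ^ k / z"
    using z by (intro divide_left_mono) auto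
  also have "\<dots> \<le> stretch_factor d P"
    unfolding stretch_factor_def D using L z by (intro divide_right_mono) auto
  finally show ?thesis using len chain par by blast
qed

end

section \<open>A space-filling generator\<close>

text \<open>Stacks copies of \<open>w\<close> along axis \<open>a\<close>, traversed alternately
  forwards and backwards, so that each level begins above the point where the previous one
  ended.\<close>

definition snake :: "nat \<Rightarrow> nat \<Rightarrow> (nat \<Rightarrow> nat \<Rightarrow> int) \<Rightarrow> nat \<Rightarrow> nat \<Rightarrow> int" where
  "snake a M w t =
     (w (if even (t div M) then t mod M else M - 1 - t mod M))(a := int (t div M))"

lemma lattice_path_mono: "lattice_path d M w \<Longrightarrow> d \<le> d' \<Longrightarrow> lattice_path d' M w"
  unfolding lattice_path_def adjacent_def by (meson order_less_le_trans)

lemma adjacent_upd: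
  assumes "adjacent d x y" "x a = y a"
  shows "adjacent d (x(a := q)) (y(a := q))"
proof -
  obtain b \<sigma> where b: "b < d" "\<bar>\<sigma>\<bar> = 1" "y = x(b := x b + \<sigma>)"
    using assms(1) by (auto simp: adjacent_def)
  then have "a \<noteq> b" using assms(2) by auto
  then have "y(a := q) = (x(a := q))(b := (x(a := q)) b + \<sigma>)" using b(3) by auto
  then show ?thesis using b(1,2) unfolding adjacent_def by blast
qed

lemma adjacent_shift:
  assumes "adjacent d x y"
  shows "adjacent d (x(a := x a + s)) (y(a := y a + s))"
proof -
  obtain b \<sigma> where b: "b < d" "\<bar>\<sigma>\<bar> = 1" "y = x(b := x b + \<sigma>)"
    using assms by (auto simp: adjacent_def)
  then have "y(a := y a + s) = (x(a := x a + s))(b := (x(a := x a + s)) b + \<sigma>)" by auto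
  then show ?thesis using b(1,2) unfolding adjacent_def by blast
qed

text \<open>Coordinate \<open>a\<close> reveals the level, and resetting it to 0 reveals the
  position on \<open>w\<close>; this gives injectivity. Within a level the edges are those of
  \<open>w\<close>, and a change of level is one step along \<open>a\<close>.\<close>

lemma lattice_path_snake:
  assumes w: "lattice_path d M w" and M: "M > 0" and a: "a < d"
    and w0: "\<And>i. i < M \<Longrightarrow> w i a = 0"
  shows "lattice_path d n (snake a M w)"
proof -
  define p where "p = (\<lambda>t. if even (t div M) then t mod M else M - 1 - t mod M)"
  have p: "p t < M" for t using M by (auto simp: p_def)
  have sn: "snake a M w t = (w (p t))(a := int (t div M))" for t by (simp add: snake_def p_def)
  have "inj_on (snake a M w) {..<n}"
  proof (rule inj_onI)
    fix s t assume e: "snake a M w s = snake a M w t"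
    have q: "s div M = t div M" using fun_cong[OF e, of a] by (simp add: sn)
    have "w (p s) = (snake a M w s)(a := 0)" using w0[OF p] by (auto simp: sn)
    also have "\<dots> = w (p t)" using w0[OF p] unfolding e by (auto simp: sn)
    finally have "p s = p t" using w p by (auto simp: lattice_path_def inj_on_def)
    then have "s mod M = t mod M \<or> M - 1 - s mod M = M - 1 - t mod M"
      unfolding p_def q by (auto split: if_splits)
    moreover have "s mod M < M" "t mod M < M" using M by auto
    ultimately have "s mod M = t mod M" by linarith
    then show "s = t" using q by (metis div_mult_mod_eq)
  qed
  moreover have "adjacent d (snake a M w t) (snake a M w (Suc t))" for t
  proof (cases "Suc (t mod M) < M")
    case True
    then have dm: "Suc t div M = t div M" "Suc t mod M = Suc (t mod M)"
      by (auto simp: div_Suc mod_Suc)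
    have "adjacent d (w (p t)) (w (p (Suc t)))"
    proof (cases "even (t div M)")
      case ev: True
      then show ?thesis using w True dm by (simp add: p_def lattice_path_def)
    next
      case od: False
      have "Suc (p (Suc t)) = p t" using od dm True by (simp add: p_def)
      then show ?thesis using w p[of t] adjacent_sym by (metis lattice_path_def)
    qed
    then show ?thesis using adjacent_upd[of d _ _ a] w0[OF p] dm by (simp add: sn)
  next
    case False
    then have tm: "t mod M = M - 1" using mod_less_divisor[OF M, of t] by linarith
    then have dm: "Suc t div M = Suc (t div M)" "Suc t mod M = 0"
      using M by (auto simp: div_Suc mod_Suc)
    have "p (Suc t) = p t" using tm dm by (auto simp: p_def)
    then have "snake a M w (Suc t) = (snake a M w t)(a := snake a M w t a + 1)"
      by (auto simp: sn dm)
    then show ?thesis using a unfolding adjacent_def by (metis abs_one)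
  qed
  ultimately show ?thesis by (simp add: lattice_path_def)
qed

text \<open>The cube occupies the axes 1 to \<open>e\<close>, each induction step snaking along axis
  \<open>e + 1\<close>. Axis \<open>0\<close> stays free for a final snake with a different number
  of levels.\<close>

lemma cube_path:
  "\<exists>w. lattice_path (Suc e) ((q + 1) ^ e) w \<and> w 0 = (\<lambda>j. 0) \<and>
    (\<forall>i<(q + 1) ^ e. \<forall>j. 0 \<le> w i j \<and> w i j \<le> int q \<and> (j = 0 \<or> e < j \<longrightarrow> w i j = 0))"
proof (induction e)
  case 0
  show ?case
    by (intro exI[of _ "\<lambda>i j. 0"]) (auto simp: lattice_path_def inj_on_def)
next
  case (Suc e)
  define M where "M = (q + 1) ^ e"
  have M: "M > 0" by (simp add: M_def)
  obtain w where w: "lattice_path (Suc e) M w" "w 0 = (\<lambda>j. 0)"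
    "\<And>i j. i < M \<Longrightarrow> 0 \<le> w i j \<and> w i j \<le> int q \<and> (j = 0 \<or> e < j \<longrightarrow> w i j = 0)"
    using Suc unfolding M_def by blast
  let ?s = "snake (Suc e) M w"
  have "lattice_path (Suc (Suc e)) ((q + 1) ^ Suc e) ?s"
    using lattice_path_snake[OF lattice_path_mono[OF w(1)] M] w(3) by simp
  moreover have "?s 0 = (\<lambda>j. 0)" using w(2) by (auto simp: snake_def)
  moreover have "0 \<le> ?s t j \<and> ?s t j \<le> int q \<and> (j = 0 \<or> Suc e < j \<longrightarrow> ?s t j = 0)"
    if "t < (q + 1) ^ Suc e" for t j
  proof -
    have "t div M < q + 1" using that by (simp add: M_def less_mult_imp_div_less)
    moreover have "(if even (t div M) then t mod M else M - 1 - t mod M) < M" using M by auto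
    ultimately show ?thesis using w(3) by (auto simp: snake_def)
  qed
  ultimately show ?case by blast
qed

lemma spindle_divide:
  assumes "M > 0" "0 \<le> y 0" "y 0 \<le> M"
    and "\<And>j. j \<noteq> 0 \<Longrightarrow> 2 * \<bar>y j\<bar> \<le> y 0 \<and> 2 * \<bar>y j\<bar> \<le> M - y 0"
  shows "(\<lambda>j. y j / M) \<in> spindle"
proof -
  have "2 * \<bar>y j / M\<bar> \<le> y 0 / M \<and> 2 * \<bar>y j / M\<bar> \<le> 1 - y 0 / M" if "j \<noteq> 0" for j
  proof -
    have "2 * \<bar>y j / M\<bar> = 2 * \<bar>y j\<bar> / M" "1 - y 0 / M = (M - y 0) / M"
      using assms(1) by (simp_all add: diff_divide_distrib)
    then show ?thesis using assms(1) assms(4)[OF that] by (simp add: divide_right_mono)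
  qed
  then show ?thesis using assms(1-3) by (simp add: spindle_def)
qed

text \<open>A straight piece of \<open>2 * q + 1\<close> edges along axis \<open>0\<close>, a snake
  with \<open>2 * q + 2\<close> levels over the cube of the remaining axes, and a straight piece
  again, with total height \<open>6 * q + 3\<close>. The straight pieces bring the block to where
  the double cone is wide enough for it.\<close>

lemma generator_exists:
  assumes "d \<ge> 2" "q \<ge> 1"
  shows "\<exists>v ax sg. generator d (6 * q + 3) (4 * q + 1 + 2 * (q + 1) ^ d) v ax sg"
proof -
  define M where "M = (q + 1) ^ (d - 1)"
  define B where "B = 2 * (q + 1) ^ d"
  define s where "s = 2 * q + 1"
  define N where "N = 4 * q + 1 + B"
  have M: "M > 0" by (simp add: M_def)
  have "(q + 1) ^ d = (q + 1) * M" using assms by (simp add: M_def flip: power_Suc)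
  then have B: "B = (2 * q + 2) * M" by (simp add: B_def)
  have B0: "B > 0" using M B by simp
  obtain w where w: "lattice_path d M w" "w 0 = (\<lambda>j. 0)"
    "\<And>i j. i < M \<Longrightarrow> 0 \<le> w i j \<and> w i j \<le> int q \<and> (j = 0 \<or> d - 1 < j \<longrightarrow> w i j = 0)"
    using cube_path[of "d - 1" q] assms unfolding M_def by auto
  define S where "S = snake 0 M w"
  have S: "lattice_path d B S"
    using lattice_path_snake[OF w(1) M] w(3) assms by (simp add: S_def)
  have S_first: "S 0 = (\<lambda>j. 0)" using w(2) by (auto simp: S_def snake_def)
  \<comment> \<open>The number of levels is even, so the last one is traversed backwards and the
    path returns to axis \<open>0\<close>, where the second straight piece can start.\<close>
  have S_last: "S (B - 1) = (\<lambda>j. 0)(0 := 2 * int q + 1)"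
  proof -
    have "B - 1 = M - 1 + (2 * q + 1) * M" using M by (simp add: B algebra_simps)
    then have "(B - 1) div M = 2 * q + 1" "(B - 1) mod M = M - 1"
      using M div_mult_self1[of M "M - 1" "2 * q + 1"] mod_mult_self1[of "M - 1" "2 * q + 1" M]
      by (simp_all only:) simp_all
    then show ?thesis using w(2) by (auto simp: S_def snake_def)
  qed
  have S_bounds: "0 \<le> S i 0" "S i 0 \<le> 2 * int q + 1" "j \<noteq> 0 \<Longrightarrow> 0 \<le> S i j \<and> S i j \<le> int q"
    if "i < B" for i j
  proof -
    have "i div M < 2 * q + 2" using that by (simp add: B less_mult_imp_div_less)
    then show "0 \<le> S i 0" "S i 0 \<le> 2 * int q + 1" by (auto simp: S_def snake_def)
    define l where "l = (if even (i div M) then i mod M else M - 1 - i mod M)"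
    have l: "l < M" using M by (auto simp: l_def)
    show "0 \<le> S i j \<and> S i j \<le> int q" if "j \<noteq> 0"
      using w(3)[OF l, of j] that unfolding S_def snake_def l_def[symmetric] by simp
  qed
  define u where "u = (\<lambda>i. (S i)(0 := S i 0 + int s))"
  \<comment> \<open>The first vertex after the block has index \<open>s + B\<close> and height
    \<open>s + 2 * q + 2\<close>, whence the offset in the third piece.\<close>
  define v :: "nat \<Rightarrow> nat \<Rightarrow> int" where
    "v = (\<lambda>t. if t < s then (\<lambda>j. 0)(0 := int t) else if t < s + B then u (t - s)
       else (\<lambda>j. 0)(0 := int t + 2 * int q + 2 - int B))"
  \<comment> \<open>Two kinds of edges remain to be checked: unit steps up axis \<open>0\<close>,
    among them those that enter and leave the block, and edges inside the block.\<close>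
  have edge: "(\<exists>\<tau>. 0 \<le> \<tau> \<and> \<tau> < 6 * int q + 3 \<and> v i = (\<lambda>j. 0)(0 := \<tau>) \<and> v (Suc i) = (\<lambda>j. 0)(0 := \<tau> + 1))
     \<or> (\<exists>l. Suc l < B \<and> v i = u l \<and> v (Suc i) = u (Suc l))" if "i < N" for i
  proof -
    consider "i < s" | "s \<le> i" "Suc i < s + B" | "Suc i = s + B" | "s + B \<le> i" by linarith
    then show ?thesis
    proof cases
      case 1
      then have "v i = (\<lambda>j. 0)(0 := int i) \<and> v (Suc i) = (\<lambda>j. 0)(0 := int i + 1)"
        using B0 by (cases "Suc i = s") (auto simp: v_def u_def S_first)
      then show ?thesis using 1 by (intro disjI1 exI[of _ "int i"]) (auto simp: s_def)
    next
      case 2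
      then have "Suc (i - s) < B \<and> v i = u (i - s) \<and> v (Suc i) = u (Suc (i - s))"
        by (auto simp: v_def Suc_diff_le)
      then show ?thesis by blast
    next
      case 3
      then have "i - s = B - 1" "i < s + B" "\<not> i < s" "int (Suc i) = int s + int B" using B0 by linarith+
      then have "v i = u (B - 1)"
        "v (Suc i) = (\<lambda>j. 0)(0 := int (Suc i) + 2 * int q + 2 - int B)"
        using 3 by (simp_all add: v_def)
      moreover define \<tau> where "\<tau> = 2 * int q + 1 + int s"
      have "u (B - 1) = (\<lambda>j. 0)(0 := \<tau>)" unfolding u_def S_last \<tau>_def by simp
      moreover have "int (Suc i) + 2 * int q + 2 - int B = \<tau> + 1"
        unfolding 3 \<tau>_def by simp
      ultimately have "v i = (\<lambda>j. 0)(0 := \<tau>)" "v (Suc i) = (\<lambda>j. 0)(0 := \<tau> + 1)" by metis+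
      moreover have "0 \<le> \<tau>" "\<tau> < 6 * int q + 3"
        using assms by (simp_all add: s_def \<tau>_def)
      ultimately show ?thesis by (intro disjI1 exI[of _ \<tau>] conjI)
    next
      case 4
      define \<tau> where "\<tau> = int i + 2 * int q + 2 - int B"
      have "v i = (\<lambda>j. 0)(0 := \<tau>)" using 4 by (simp add: v_def \<tau>_def)
      moreover have "v (Suc i) = (\<lambda>j. 0)(0 := int (Suc i) + 2 * int q + 2 - int B)"
        using 4 by (simp add: v_def)
      moreover have "int (Suc i) + 2 * int q + 2 - int B = \<tau> + 1" by (simp add: \<tau>_def)
      ultimately have "v i = (\<lambda>j. 0)(0 := \<tau>)" "v (Suc i) = (\<lambda>j. 0)(0 := \<tau> + 1)" by metis+
      moreover have "0 \<le> \<tau>" "\<tau> < 6 * int q + 3"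
        using 4 that unfolding \<tau>_def N_def by linarith+
      ultimately show ?thesis by (intro disjI1 exI[of _ \<tau>] conjI)
    qed
  qed
  have "\<forall>i. \<exists>a \<sigma>. i < N \<longrightarrow> a < d \<and> \<bar>\<sigma>\<bar> = 1 \<and> v (Suc i) = (v i)(a := v i a + \<sigma>)"
  proof
    fix i
    have "adjacent d (v i) (v (Suc i))" if "i < N"
      using edge[OF that]
    proof (elim disjE exE conjE)
      fix \<tau> assume "v i = (\<lambda>j. 0)(0 := \<tau>)" "v (Suc i) = (\<lambda>j. 0)(0 := \<tau> + 1)"
      then show ?thesis using assms unfolding adjacent_def by (intro exI[of _ 0] conjI exI[of _ 1]) auto
    next
      fix l assume "Suc l < B" "v i = u l" "v (Suc i) = u (Suc l)"
      then show ?thesis using S adjacent_shift by (simp add: u_def lattice_path_def)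
    qed
    then show "\<exists>a \<sigma>. i < N \<longrightarrow> a < d \<and> \<bar>\<sigma>\<bar> = 1 \<and> v (Suc i) = (v i)(a := v i a + \<sigma>)"
      unfolding adjacent_def by blast
  qed
  from choice[OF this] obtain ax where
    "\<forall>i. \<exists>\<sigma>. i < N \<longrightarrow> ax i < d \<and> \<bar>\<sigma>\<bar> = 1 \<and> v (Suc i) = (v i)(ax i := v i (ax i) + \<sigma>)"
    by (elim exE)
  from choice[OF this] obtain sg where
    "\<forall>i. i < N \<longrightarrow> ax i < d \<and> \<bar>sg i\<bar> = 1 \<and> v (Suc i) = (v i)(ax i := v i (ax i) + sg i)"
    by (elim exE)
  then have step: "ax i < d \<and> \<bar>sg i\<bar> = 1 \<and> v (Suc i) = (v i)(ax i := v i (ax i) + sg i)"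
    if "i < N" for i using that by (elim allE impE)
  have v_low: "v i 0 < int s" if "i < s" for i using that by (simp add: v_def)
  have v_mid: "int s \<le> v i 0" "v i 0 \<le> int s + 2 * int q + 1" if "s \<le> i" "i < s + B" for i
    using that S_bounds[of "i - s"] by (auto simp: v_def u_def)
  have v_high: "int s + 2 * int q + 1 < v i 0" if "s + B \<le> i" for i
    using that by (simp add: v_def)
  \<comment> \<open>The three pieces occupy disjoint ranges of height, so two equal vertices belong
    to the same piece.\<close>
  have low: "i < s \<longleftrightarrow> v i 0 < int s" for i
    using v_low[of i] v_mid(1)[of i] v_high[of i] by (cases "i < s"; cases "i < s + B") auto
  have high: "s + B \<le> i \<longleftrightarrow> int s + 2 * int q + 1 < v i 0" for i
    using v_low[of i] v_mid(2)[of i] v_high[of i] by (cases "i < s"; cases "i < s + B") auto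
  have inj: "inj_on v {..N}"
  proof (rule inj_onI)
    fix i j assume e: "v i = v j"
    note e0 = fun_cong[OF e, of 0]
    consider "i < s" "j < s" | "s \<le> i" "i < s + B" "s \<le> j" "j < s + B" | "s + B \<le> i" "s + B \<le> j"
      using low[of i] low[of j] high[of i] high[of j] unfolding e0 by (meson not_le)
    then show "i = j"
    proof cases
      case 2
      then have "u (i - s) = u (j - s)" using e by (simp add: v_def)
      then have "S (i - s) = S (j - s)"
        unfolding u_def by (metis (no_types, opaque_lifting) add_right_cancel fun_upd_eqD fun_upd_triv fun_upd_upd)
      then have "i - s = j - s" using S 2 by (auto simp: lattice_path_def inj_on_def)
      then show ?thesis using 2 by simp
    qed (use e0 in \<open>auto simp: v_def\<close>)
  qed
  have bulk: "real s - 1/4 \<le> real_of_int (v i 0) + turn (ax i) (sg i) x 0"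
    "real_of_int (v i 0) + turn (ax i) (sg i) x 0 \<le> real s + 2 * real q + 1 + 1/4"
    "j \<noteq> 0 \<Longrightarrow> \<bar>real_of_int (v i j) + turn (ax i) (sg i) x j\<bar> \<le> real q + 1/4"
    if "i < N" "x \<in> spindle" "Suc l < B" "v i = u l" "v (Suc i) = u (Suc l)" for i x l j
  proof -
    note t = turn_box[OF _ _ that(2), of "v (Suc i)" "v i" "ax i" "sg i"]
    have ub: "int s \<le> u l' 0" "u l' 0 \<le> int s + 2 * int q + 1" "j \<noteq> 0 \<Longrightarrow> 0 \<le> u l' j \<and> u l' j \<le> int q"
      if "l' < B" for l' j using S_bounds[OF that] by (auto simp: u_def)
    have "int s \<le> min (v i 0) (v (Suc i) 0)" "max (v i 0) (v (Suc i) 0) \<le> int s + 2 * int q + 1"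
      using ub[of l] ub[of "Suc l"] that by auto
    then have "real s \<le> real_of_int (min (v i 0) (v (Suc i) 0))"
      "real_of_int (max (v i 0) (v (Suc i) 0)) \<le> real s + 2 * real q + 1" by linarith+
    then show "real s - 1/4 \<le> real_of_int (v i 0) + turn (ax i) (sg i) x 0"
      "real_of_int (v i 0) + turn (ax i) (sg i) x 0 \<le> real s + 2 * real q + 1 + 1/4"
      using t[of 0] step[OF that(1)] by linarith+
    assume j: "j \<noteq> 0"
    have "0 \<le> min (v i j) (v (Suc i) j)" "max (v i j) (v (Suc i) j) \<le> int q"
      using ub(3)[OF _ j, of l] ub(3)[OF _ j, of "Suc l"] that by auto
    then have "0 \<le> real_of_int (min (v i j) (v (Suc i) j))"
      "real_of_int (max (v i j) (v (Suc i) j)) \<le> real q" by linarith+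
    then show "\<bar>real_of_int (v i j) + turn (ax i) (sg i) x j\<bar> \<le> real q + 1/4"
      using t[of j] step[OF that(1)] by linarith
  qed
  have straight: "real_of_int (v i j) + turn (ax i) (sg i) x j = x j + (if j = 0 then real_of_int \<tau> else 0)"
    if "i < N" "v i = (\<lambda>j. 0)(0 := \<tau>)" "v (Suc i) = (\<lambda>j. 0)(0 := \<tau> + 1)" for i \<tau> x j
  proof -
    have e: "v (Suc i) = (v i)(ax i := v i (ax i) + sg i)" using step[OF that(1)] by blast
    have "v (Suc i) 0 = v i 0 + 1" unfolding that(2,3) by simp
    from straight_edge[OF e this] show ?thesis using that(2) by (auto simp: turn_def)
  qed
  have v_first: "v 0 = (\<lambda>j. 0)" "v (Suc 0) = (\<lambda>j. 0)(0 := 1)"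
    using assms by (auto simp: v_def s_def)
  have v_last: "v N = (\<lambda>j. 0)(0 := int (6 * q + 3))" "v (N - Suc 0) = (\<lambda>j. 0)(0 := int (6 * q + 3) - 1)"
  proof -
    have "\<not> N < s" "\<not> N < s + B" using assms unfolding N_def s_def by linarith+
    moreover have "int N + 2 * int q + 2 - int B = int (6 * q + 3)" by (simp add: N_def)
    ultimately show "v N = (\<lambda>j. 0)(0 := int (6 * q + 3))"
      unfolding v_def by (simp only: if_False)
    have "\<not> N - Suc 0 < s" "\<not> N - Suc 0 < s + B" using assms unfolding N_def s_def by linarith+
    moreover have "int (N - Suc 0) + 2 * int q + 2 - int B = int (6 * q + 3) - 1" by (simp add: N_def)
    ultimately show "v (N - Suc 0) = (\<lambda>j. 0)(0 := int (6 * q + 3) - 1)"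
      unfolding v_def by (simp only: if_False)
  qed
  have "generator d (6 * q + 3) N v ax sg"
  proof
    show "0 < d" "0 < 6 * q + 3" "2 \<le> N" using assms by (auto simp: N_def)
    show "v 0 = (\<lambda>j. 0)" "v (Suc 0) = (\<lambda>j. 0)(0 := 1)" "v N = (\<lambda>j. 0)(0 := int (6 * q + 3))"
      "v (N - Suc 0) = (\<lambda>j. 0)(0 := int (6 * q + 3) - 1)" by (fact v_first v_last)+
    show "inj_on v {..N}" by (fact inj)
    show "ax i < d" "\<bar>sg i\<bar> = 1" "v (Suc i) = (v i)(ax i := v i (ax i) + sg i)" if "i < N" for i
      using step[OF that] by auto
  next
    fix i x assume i: "i < N" and x: "x \<in> spindle"
    note xs = spindleD[OF x]
    let ?y = "\<lambda>j. real_of_int (v i j) + turn (ax i) (sg i) x j"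
    have "0 \<le> ?y 0 \<and> ?y 0 \<le> 6 * real q + 3 \<and>
      (\<forall>j. j \<noteq> 0 \<longrightarrow> 2 * \<bar>?y j\<bar> \<le> ?y 0 \<and> 2 * \<bar>?y j\<bar> \<le> 6 * real q + 3 - ?y 0)"
      using edge[OF i]
    proof (elim disjE exE conjE)
      fix \<tau> assume t: "0 \<le> \<tau>" "\<tau> < 6 * int q + 3" "v i = (\<lambda>j. 0)(0 := \<tau>)" "v (Suc i) = (\<lambda>j. 0)(0 := \<tau> + 1)"
      have "0 \<le> real_of_int \<tau>" "real_of_int \<tau> + 1 \<le> 6 * real q + 3" using t by linarith+
      moreover have "2 * \<bar>x j\<bar> \<le> x 0 + \<tau> \<and> 2 * \<bar>x j\<bar> \<le> 6 * real q + 3 - (x 0 + \<tau>)"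
        if "j \<noteq> 0" for j using xs(3,4)[OF that] calculation by linarith
      ultimately show ?thesis using xs(1,2) unfolding straight[OF i t(3,4)] by auto
    next
      fix l assume l: "Suc l < B" "v i = u l" "v (Suc i) = u (Suc l)"
      \<comment> \<open>This fixes the length of the straight pieces: twice the extent
        \<open>q + 1/4\<close> is at most \<open>2 * q + 3/4\<close>, the distance that copies in
        the block keep from either end in height.\<close>
      have "2 * \<bar>?y j\<bar> \<le> ?y 0 \<and> 2 * \<bar>?y j\<bar> \<le> 6 * real q + 3 - ?y 0" if "j \<noteq> 0" for j
        using bulk(1,2)[OF i x l] bulk(3)[OF i x l that] unfolding s_def by simp
      moreover have "0 \<le> ?y 0 \<and> ?y 0 \<le> 6 * real q + 3"
        using bulk(1,2)[OF i x l] assms by (auto simp: s_def)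
      ultimately show ?thesis by blast
    qed
    then show "(\<lambda>j. ?y j / real (6 * q + 3)) \<in> spindle"
      by (intro spindle_divide) auto
  next
    fix i x assume i: "0 < i" "i < N" and x: "x \<in> spindle"
    show "1 \<le> real_of_int (v i 0) + turn (ax i) (sg i) x 0"
      using edge[OF i(2)]
    proof (elim disjE exE conjE)
      fix \<tau> assume t: "0 \<le> \<tau>" "v i = (\<lambda>j. 0)(0 := \<tau>)" "v (Suc i) = (\<lambda>j. 0)(0 := \<tau> + 1)"
      \<comment> \<open>By injectivity only edge \<open>0\<close> starts at the origin, so every
        other straight edge starts at height at least one.\<close>
      have "v i \<noteq> v 0" using inj_onD[OF inj, of i 0] i by auto
      then have "\<tau> \<noteq> 0" unfolding t(2) v_first(1) by (metis fun_upd_triv)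
      then have "1 \<le> real_of_int \<tau>" using t(1) by linarith
      then show ?thesis using spindleD(1)[OF x] unfolding straight[OF i(2) t(2,3)] by simp
    next
      fix l assume l: "Suc l < B" "v i = u l" "v (Suc i) = u (Suc l)"
      then show ?thesis using bulk(1)[OF i(2) x l] assms by (simp add: s_def)
    qed
  next
    fix i x assume i: "Suc i < N" and x: "x \<in> spindle"
    then have i': "i < N" by simp
    show "real_of_int (v i 0) + turn (ax i) (sg i) x 0 \<le> real (6 * q + 3) - 1"
      using edge[OF i']
    proof (elim disjE exE conjE)
      fix \<tau> assume t: "\<tau> < 6 * int q + 3" "v i = (\<lambda>j. 0)(0 := \<tau>)" "v (Suc i) = (\<lambda>j. 0)(0 := \<tau> + 1)"
      have "v (Suc i) \<noteq> v N" using inj_onD[OF inj, of "Suc i" N] i by auto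
      then have "\<tau> + 1 \<noteq> int (6 * q + 3)" unfolding t(3) v_last(1) by metis
      then have "real_of_int \<tau> + 1 \<le> 6 * real q + 2" using t(1) by linarith
      then show ?thesis using spindleD(2)[OF x] unfolding straight[OF i' t(2,3)] by simp
    next
      fix l assume l: "Suc l < B" "v i = u l" "v (Suc i) = u (Suc l)"
      then show ?thesis using bulk(2)[OF i' x l] assms by (simp add: s_def)
    qed
  qed
  then show ?thesis unfolding N_def B_def by blast
qed

section \<open>Choice of the parameters\<close>

text \<open>Take \<open>k\<close> with \<open>n - 1\<close> between \<open>N ^ k\<close> and
  \<open>N ^ (k + 1)\<close>. Rounding up to the next power costs a factor \<open>A\<close> and the
  halving a factor 2; both are absorbed by \<open>(b / A) ^ k\<close> once \<open>k\<close> is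
  large.\<close>

lemma power_window:
  fixes \<alpha> b :: real and N :: nat
  assumes "N \<ge> 2" "\<alpha> \<ge> 0" "N powr \<alpha> < b"
  shows "\<exists>n\<^sub>0>0. \<forall>n\<ge>n\<^sub>0. \<exists>k. N ^ k < n \<and> (real n - 1) powr \<alpha> \<le> b ^ k / 2"
proof -
  define A where "A = real N powr \<alpha>"
  have A: "A > 0" using assms by (simp add: A_def)
  then have "b / A > 1" using assms by (simp add: A_def)
  then obtain k0 where k0: "2 * A < (b / A) ^ k0" using real_arch_pow by blast
  have "\<exists>k. N ^ k < n \<and> (real n - 1) powr \<alpha> \<le> b ^ k / 2" if n: "n \<ge> N ^ k0 + 1" for n
  proof -
    have "N ^ k0 > 0" using assms by simp
    then have "1 \<le> n - 1" using n by linarith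
    then obtain k where k: "N ^ k \<le> n - 1" "n - 1 < N ^ (k + 1)"
      using ex_power_ivl1[of N "n - 1"] assms by blast
    have "N ^ k0 < N ^ (k + 1)" using n k by linarith
    then have "k0 < k + 1" using assms(1) power_less_imp_less_exp[of N k0 "k + 1"] by linarith
    then have kk: "(b / A) ^ k0 \<le> (b / A) ^ k" using \<open>b / A > 1\<close> by (intro power_increasing) auto
    have "(real n - 1) powr \<alpha> \<le> (real N ^ (k + 1)) powr \<alpha>"
    proof (rule powr_mono2)
      have "real (n - 1) \<le> real (N ^ (k + 1))" using k by linarith
      then show "real n - 1 \<le> real N ^ (k + 1)" using n by simp
    qed (use assms n in auto)
    also have "\<dots> = A ^ (k + 1)"
      using assms by (simp only: A_def powr_powr flip: powr_realpow) (simp add: powr_powr powr_add distrib_left mult.commute flip: powr_realpow)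
    also have "\<dots> = (2 * A) * A ^ k / 2" by simp
    also have "\<dots> \<le> (b / A) ^ k * A ^ k / 2" using k0 kk A by (intro divide_right_mono mult_right_mono) auto
    also have "\<dots> = b ^ k / 2" using A by (simp add: power_divide)
    finally show ?thesis using k(1) \<open>1 \<le> n - 1\<close> by (intro exI[of _ k]) auto
  qed
  then show ?thesis by (intro exI[of _ "N ^ k0 + 1"]) auto
qed

text \<open>With \<alpha> the exponent, d (1 - \<alpha>) = 1 + \<epsilon> (d - 1) is at least 1 +
  \<epsilon>, so \<open>N\<close> to the power 1 - \<alpha> is at least (q + 1) to the power 1 +
  \<epsilon>, hence at least 6 (q + 1). The condition on \<open>q\<close> is the same for all
  \<open>d\<close>.\<close>

lemma exponent_gap:
  fixes \<epsilon> :: real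
  assumes "d \<ge> 2" "\<epsilon> > 0" "6 \<le> (real q + 1) powr \<epsilon>" "real N \<ge> (real q + 1) ^ d"
  shows "N powr ((1 - \<epsilon>) * (real d - 1) / real d) < N / real (6 * q + 3)"
proof -
  define \<alpha> where "\<alpha> = (1 - \<epsilon>) * (real d - 1) / real d"
  have d: "real d \<ge> 2" using assms by simp
  have q: "0 < (real q + 1) ^ d" by (intro zero_less_power) simp
  then have N: "0 < real N" using assms(4) by linarith
  have e: "real d * (1 - \<alpha>) = 1 + \<epsilon> * (real d - 1)" using d by (simp add: \<alpha>_def field_simps)
  have "\<epsilon> * 1 \<le> \<epsilon> * (real d - 1)" using assms(2) d by (intro mult_left_mono) auto
  then have e2: "1 + \<epsilon> \<le> real d * (1 - \<alpha>)" using e by simp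
  then have "0 \<le> real d * (1 - \<alpha>)" using assms(2) by linarith
  then have a: "0 \<le> 1 - \<alpha>" using d by (simp add: zero_le_mult_iff)
  have "real (6 * q + 3) < (real q + 1) * 6" by simp
  also have "\<dots> \<le> (real q + 1) * (real q + 1) powr \<epsilon>" using assms(3) by (intro mult_left_mono) auto
  also have "\<dots> = (real q + 1) powr (1 + \<epsilon>)" by (simp add: powr_add)
  also have "\<dots> \<le> (real q + 1) powr (real d * (1 - \<alpha>))" using e2 by (intro powr_mono) auto
  also have "\<dots> = ((real q + 1) ^ d) powr (1 - \<alpha>)" by (simp add: powr_powr flip: powr_realpow)
  also have "\<dots> \<le> real N powr (1 - \<alpha>)" using assms(4) q a by (intro powr_mono2) auto
  also have "\<dots> = N / N powr \<alpha>" using N by (simp add: powr_diff)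
  finally show ?thesis using N unfolding \<alpha>_def[symmetric] by (simp add: field_simps)
qed

theorem theorem9:
  fixes \<epsilon> :: real
  assumes "\<epsilon> > 0"
  shows "\<exists>K::real. K > 0 \<and>
    (\<forall>(d::nat) (c::real). d \<ge> 2 \<longrightarrow> c \<ge> K * real d \<longrightarrow>
      (\<exists>n\<^sub>0::nat. n\<^sub>0 > 0 \<and>
        (\<forall>n\<ge>n\<^sub>0. \<exists>P. length P = n \<and> c_chain d c P \<and> axis_parallel d P \<and>
          stretch_factor d P \<ge> (real n - 1) powr ((1 - \<epsilon>) * (real d - 1) / real d))))"
proof -
  \<comment> \<open>For \<epsilon> above 1 the exponent would be negative, while
    \<open>power_window\<close> needs a nonnegative one. Decreasing \<epsilon> only strengthens the
    claim, as the base is at least 1.\<close>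
  define \<delta> where "\<delta> = min \<epsilon> 1"
  have \<delta>: "0 < \<delta>" "\<delta> \<le> 1" "\<delta> \<le> \<epsilon>" using assms by (auto simp: \<delta>_def)
  \<comment> \<open>Chosen from \<delta> alone, so that \<open>m\<close>, and with it the constant
    \<open>4 * m + 5\<close>, does not depend on \<open>d\<close>.\<close>
  define q where "q = nat \<lceil>6 powr (1 / \<delta>)\<rceil>"
  have "6 powr (1 / \<delta>) > 0" by simp
  then have q: "q \<ge> 1" unfolding q_def by linarith
  have "6 powr (1 / \<delta>) \<le> real q + 1" unfolding q_def by linarith
  then have "(6 powr (1 / \<delta>)) powr \<delta> \<le> (real q + 1) powr \<delta>" using \<delta> by (intro powr_mono2) auto
  then have q6: "6 \<le> (real q + 1) powr \<delta>" using \<delta> by (simp add: powr_powr)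
  define m where "m = 6 * q + 3"
  show ?thesis
  proof (intro exI[of _ "4 * real m + 5"] conjI allI impI)
    fix d :: nat and c :: real
    assume d: "2 \<le> d" and c: "(4 * real m + 5) * real d \<le> c"
    define N where "N = 4 * q + 1 + 2 * (q + 1) ^ d"
    obtain v ax sg where "generator d m N v ax sg"
      using generator_exists[OF d q] unfolding m_def N_def by blast
    then interpret generator d m N v ax sg .
    define \<alpha> where "\<alpha> = (1 - \<delta>) * (real d - 1) / real d"
    have \<alpha>: "0 \<le> \<alpha>" using \<delta> d by (simp add: \<alpha>_def)
    have "real ((q + 1) ^ d) \<le> real N" unfolding N_def by (intro of_nat_mono) simp
    then have "real N powr \<alpha> < real N / m"
      unfolding \<alpha>_def m_def using exponent_gap[OF d \<delta>(1) q6, of N] by (simp add: add.commute)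
    then obtain n0 where n0: "n0 > 0"
      "\<forall>n\<ge>n0. \<exists>k. N ^ k < n \<and> (real n - 1) powr \<alpha> \<le> (real N / m) ^ k / 2"
      using power_window[OF N_ge \<alpha>] by blast
    show "\<exists>n\<^sub>0>0. \<forall>n\<ge>n\<^sub>0. \<exists>P. length P = n \<and> c_chain d c P \<and> axis_parallel d P \<and>
          (real n - 1) powr ((1 - \<epsilon>) * (real d - 1) / real d) \<le> stretch_factor d P"
    proof (intro exI[of _ n0] conjI allI impI)
      fix n assume "n0 \<le> n"
      then obtain k where k: "N ^ k < n" "(real n - 1) powr \<alpha> \<le> (real N / m) ^ k / 2" using n0 by blast
      have "N ^ k > 0" using N_pos by simp
      then have "1 \<le> real n - 1" using k(1) by linarith
      moreover have "(1 - \<epsilon>) * (real d - 1) / real d \<le> \<alpha>"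
        unfolding \<alpha>_def using \<delta> d by (intro divide_right_mono mult_right_mono) auto
      ultimately have "(real n - 1) powr ((1 - \<epsilon>) * (real d - 1) / real d) \<le> (real n - 1) powr \<alpha>"
        by (intro powr_mono) auto
      also note k(2)
      finally show "\<exists>P. length P = n \<and> c_chain d c P \<and> axis_parallel d P \<and>
          (real n - 1) powr ((1 - \<epsilon>) * (real d - 1) / real d) \<le> stretch_factor d P"
        using prolonged_chain[OF k(1) c] order_trans by blast
    qed (fact n0(1))
  qed (simp add: m_def)
qed

end
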